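(* Let $\Delta$ be a simplicial complex on the finite vertex set $\mathcal V=\{1,\dots,n\}$, let $f_i$ be the number of faces of $\Delta$ of dimension $i$ (with $f_{-1}=1$), let $d=\dim\Delta+1$, and let $e=|\{i\in\mathcal V\mid\{i\}\notin\Delta\}|$. The Hilbert series $H_{cl}(k[\Delta],t)=\sum_{j\ge 0}\dim_k(k[\Delta]_j)\,t^j$ of the Stanley–Reisner ring is $$H_{cl}(k[\Delta],t)=\frac{1}{(1-t)^d}\sum_{i=0}^df_{i-1}(1-t)^{d-i}t^i=\frac{1}{(1-t)^{d+e}}\sum_{m\in\mathbf N^B}g(m)(1-t)^{d-\mu(m)}\prod_{s\in\operatorname{supp}m}\big(1-(1-t)^s\big)^{m(s)},$$ where $B$ is the set of sizes of the strata of $\mathcal V$, $g(m)$ are the face multiplicities and $\mu(m)$ is the mass of $m$.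
   Context: $k$ is a field (algebraically closed of characteristic $0$). $\Delta\subset 2^{\mathcal V}$ is an abstract simplicial complex; $\Delta_{fc}$ is its set of facets (maximal faces); $\dim\sigma=|\sigma|-1$. With $x^\sigma=\prod_{i\in\sigma}x_i$, $I_\Delta=(x^\sigma\mid\sigma\subset\mathcal V,\ \sigma\notin\Delta)$ and $k[\Delta]=k[x_1,\dots,x_n]/I_\Delta$ with its standard grading. Stratification: for $\lambda\subset\Delta_{fc}$ put $$\mathcal V_\lambda=\bigcap_{F\in\lambda}F\ \setminus\bigcup_{G\in\Delta_{fc},\ \bigcap_{F\in\lambda}F\not\subset G}\Big(G\cap\bigcap_{F\in\lambda}F\Big)$$ (an empty intersection being $\mathcal V$). If $\mathcal V_\lambda\cap\mathcal V_{\lambda'}\neq\emptyset$ then $\mathcal V_\lambda=\mathcal V_{\lambda'}$; let $\Omega$ index the distinct nonempty sets $\mathcal V_\omega$ so obtained, which partition $\mathcal V$ (two vertices lie in the same stratum iff they lie in exactly the same facets). Put $d_\omega=|\mathcal V_\omega|$. For $\sigma\in\Delta$ put $\sigma_\omega=\sigma\cap\mathcal V_\omega$ and $\tilde\sigma=\{\omega\in\Omega\mid\sigma_\omega\ne\emptyset\}$; $\tilde\Delta=\{\tilde\sigma\mid\sigma\in\Delta\}\subset 2^\Omega$ is a simplicial complex on $\Omega$, the essential simplicial complex of $\Delta$. Let $B=\{d_\omega\}_{\omega\in\Omega}\subset\mathbf N_{\ge 1}$ and $\mathbf N^B$ the set of functions $m:B\to\mathbf N$ (values $\ge 0$). Each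 face $\tilde\sigma\in\tilde\Delta$ defines $m_\sigma\in\mathbf N^B$ by $m_\sigma(s)=|\{\omega\in\Omega\mid\sigma_\omega\neq\emptyset,\ d_\omega=s\}|$; this depends only on $\tilde\sigma$. The support of $m$ is $\operatorname{supp}m=\{s\mid m(s)\ne 0\}$, its mass is $\mu(m)=\sum_{s\in\operatorname{supp}m}s\,m(s)$, and its face multiplicity $g(m)$ is the number of faces $\tilde\sigma\in\tilde\Delta$ with $m_\sigma=m$.
   Formalization: In the last expression the exponent d−μ(m) is corrected to d+e−μ(m); as printed it fails whenever e>0 (V={1}, Δ={∅}: series is 1, printed formula gives 1/(1−t)). For e=0 the printed formula is proved as it stands. *)

theory Defs
  imports
    "HOL-Algebra.Embedded_Algebras"
    "HOL-Algebra.QuotRing"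
    "HOL-Library.Poly_Mapping"
    "HOL-Computational_Algebra.Polynomial"
    "HOL-Computational_Algebra.Formal_Power_Series"
begin

section \<open>Simplicial complexes\<close>

text \<open>
  Singletons of vertices need not be faces, but the empty set is always a face
  (so that \<open>f\<^sub>-\<^sub>1 = 1\<close>).
\<close>

definition simplicial_complex :: "'v set \<Rightarrow> 'v set set \<Rightarrow> bool" where
  "simplicial_complex V \<Delta> \<longleftrightarrow>
     \<Delta> \<subseteq> Pow V \<and> {} \<in> \<Delta> \<and> (\<forall>\<sigma>\<in>\<Delta>. \<forall>\<tau>. \<tau> \<subseteq> \<sigma> \<longrightarrow> \<tau> \<in> \<Delta>)"

definition facets :: "'v set set \<Rightarrow> 'v set set" where
  "facets \<Delta> = {F \<in> \<Delta>. \<forall>G\<in>\<Delta>. F \<subseteq> G \<longrightarrow> G = F}"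

definition face_dim :: "'v set \<Rightarrow> int" where
  "face_dim \<sigma> = int (card \<sigma>) - 1"

definition complex_dim :: "'v set set \<Rightarrow> int" where
  "complex_dim \<Delta> = Max (face_dim ` \<Delta>)"

definition face_number :: "'v set set \<Rightarrow> int \<Rightarrow> nat" where
  "face_number \<Delta> i = card {\<sigma> \<in> \<Delta>. face_dim \<sigma> = i}"


section \<open>Stanley--Reisner rings and their Hilbert series\<close>

text \<open>
  A polynomial is a finitely supported map from exponent vectors (finitely supported maps
  from variables to exponents) to coefficients.
\<close>

type_synonym ('v, 'k) mpoly = "('v \<Rightarrow>\<^sub>0 nat) \<Rightarrow>\<^sub>0 'k"

definition mpoly_ring :: "'v set \<Rightarrow> ('v, 'k::field) mpoly ring" where
  "mpoly_ring V =
     \<lparr>carrier = {p. \<forall>a\<in>Poly_Mapping.keys p. Poly_Mapping.keys a \<subseteq> V},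
      monoid.mult = (*), one = 1, zero = 0, add = (+)\<rparr>"

definition mpoly_const :: "'k \<Rightarrow> ('v, 'k::field) mpoly" where
  "mpoly_const c = Poly_Mapping.single 0 c"

definition mpoly_var :: "'v \<Rightarrow> ('v, 'k::field) mpoly" where
  "mpoly_var i = Poly_Mapping.single (Poly_Mapping.single i 1) 1"

definition homogeneous :: "nat \<Rightarrow> ('v, 'k::field) mpoly \<Rightarrow> bool" where
  "homogeneous j p \<longleftrightarrow>
     (\<forall>a\<in>Poly_Mapping.keys p. (\<Sum>i\<in>Poly_Mapping.keys a. Poly_Mapping.lookup a i) = j)"

definition SR_ideal :: "'v set \<Rightarrow> 'v set set \<Rightarrow> ('v, 'k::field) mpoly set" where
  "SR_ideal V \<Delta> = genideal (mpoly_ring V) {\<Prod>i\<in>\<sigma>. mpoly_var i | \<sigma>. \<sigma> \<subseteq> V \<and> \<sigma> \<notin> \<Delta>}"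

definition SR_ring :: "'v set \<Rightarrow> 'v set set \<Rightarrow> ('v, 'k::field) mpoly set ring" where
  "SR_ring V \<Delta> = mpoly_ring V Quot SR_ideal V \<Delta>"

definition SR_class :: "'v set \<Rightarrow> 'v set set \<Rightarrow> ('v, 'k::field) mpoly \<Rightarrow> ('v, 'k) mpoly set" where
  "SR_class V \<Delta> p = SR_ideal V \<Delta> +>\<^bsub>mpoly_ring V\<^esub> p"

text \<open>The copy of the ground field inside the Stanley--Reisner ring.\<close>

definition SR_scalars :: "'v set \<Rightarrow> 'v set set \<Rightarrow> ('v, 'k::field) mpoly set set" where
  "SR_scalars V \<Delta> = range (\<lambda>c. SR_class V \<Delta> (mpoly_const c))"

definition SR_graded_part :: "'v set \<Rightarrow> 'v set set \<Rightarrow> nat \<Rightarrow> ('v, 'k::field) mpoly set set" where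
  "SR_graded_part V \<Delta> j = SR_class V \<Delta> ` {p \<in> carrier (mpoly_ring V). homogeneous j p}"

text \<open>
  The type argument is the ground field. The coefficients are natural numbers; they are
  embedded into the rationals so that division of power series is available.
\<close>

definition hilbert_series :: "'k::field itself \<Rightarrow> 'v set \<Rightarrow> 'v set set \<Rightarrow> rat fps" where
  "hilbert_series _ V \<Delta> =
     Abs_fps (\<lambda>j. of_nat (ring.dim (SR_ring V \<Delta> :: ('v, 'k) mpoly set ring)
                            (SR_scalars V \<Delta>) (SR_graded_part V \<Delta> j)))"


section \<open>Strata and the essential simplicial complex\<close>

text \<open>
  Facets are subsets of \<open>V\<close>, so intersecting with \<open>V\<close> only matters for \<open>L = {}\<close>,
  where it makes the empty intersection equal to \<open>V\<close>.
\<close>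

definition facet_inter :: "'v set \<Rightarrow> 'v set set \<Rightarrow> 'v set" where
  "facet_inter V L = V \<inter> \<Inter>L"

definition stratum :: "'v set \<Rightarrow> 'v set set \<Rightarrow> 'v set set \<Rightarrow> 'v set" where
  "stratum V \<Delta> L =
     facet_inter V L -
     (\<Union>G\<in>{G \<in> facets \<Delta>. \<not> facet_inter V L \<subseteq> G}. G \<inter> facet_inter V L)"

text \<open>The distinct nonempty strata serve as their own index set \<open>\<Omega>\<close>; thus \<open>d\<^sub>\<omega> = card \<omega>\<close>.\<close>

definition strata :: "'v set \<Rightarrow> 'v set set \<Rightarrow> 'v set set" where
  "strata V \<Delta> = {stratum V \<Delta> L | L. L \<subseteq> facets \<Delta> \<and> stratum V \<Delta> L \<noteq> {}}"

definition stratum_sizes :: "'v set \<Rightarrow> 'v set set \<Rightarrow> nat set" where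
  "stratum_sizes V \<Delta> = card ` strata V \<Delta>"

definition essential_face :: "'v set \<Rightarrow> 'v set set \<Rightarrow> 'v set \<Rightarrow> 'v set set" where
  "essential_face V \<Delta> \<sigma> = {\<omega> \<in> strata V \<Delta>. \<sigma> \<inter> \<omega> \<noteq> {}}"

definition essential_complex :: "'v set \<Rightarrow> 'v set set \<Rightarrow> 'v set set set" where
  "essential_complex V \<Delta> = essential_face V \<Delta> ` \<Delta>"


section \<open>Face multiplicities\<close>

text \<open>Elements of \<open>\<nat>\<^sup>B\<close> are represented by functions on all of \<open>\<nat>\<close> vanishing outside \<open>B\<close>.\<close>

definition multi_exponents :: "nat set \<Rightarrow> (nat \<Rightarrow> nat) set" where
  "multi_exponents B = {m. \<forall>s. s \<notin> B \<longrightarrow> m s = 0}"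

definition supp :: "(nat \<Rightarrow> nat) \<Rightarrow> nat set" where
  "supp m = {s. m s \<noteq> 0}"

definition mass :: "(nat \<Rightarrow> nat) \<Rightarrow> nat" where
  "mass m = (\<Sum>s\<in>supp m. s * m s)"

text \<open>\<open>m\<^sub>\<sigma>\<close>, as a function of the face \<open>\<tau>\<close> of the essential complex determined by \<open>\<sigma>\<close>.\<close>

definition face_type :: "'v set set \<Rightarrow> nat \<Rightarrow> nat" where
  "face_type \<tau> s = card {\<omega> \<in> \<tau>. card \<omega> = s}"

definition face_multiplicity :: "'v set \<Rightarrow> 'v set set \<Rightarrow> (nat \<Rightarrow> nat) \<Rightarrow> nat" where
  "face_multiplicity V \<Delta> m = card {\<tau> \<in> essential_complex V \<Delta>. face_type \<tau> = m}"

end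

theory Submission
  imports Defs
begin

text \<open>
  The face ideal is spanned by the monomials whose support is not a face: these monomials span
  an ideal, and each of them is a multiple of the squarefree monomial of its support. Hence the
  monomials of degree \<open>j\<close> supported on faces form a basis of the \<open>j\<close>-th graded part of the
  Stanley--Reisner ring (lemmas \<open>SR_ideal_eq\<close> and \<open>dim_SR_graded_part\<close>). The monomials with
  support exactly \<open>\<sigma>\<close> have generating function \<open>(t / (1 - t))\<^sup>|\<^sup>\<sigma>\<^sup>|\<close>, so that
  the Hilbert series is the sum of these powers over all faces (\<open>hilbert_series_eq_sum_faces\<close>).

  Grouping the faces by cardinality gives the formula in the face numbers
  (\<open>sum_faces_by_dimension\<close>).

  For the second formula the faces are grouped by essential face. A facet contains every stratum
  that it meets, so the union of the strata met by a face is again a face, and the faces with a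
  given essential face \<open>\<tau>\<close> are obtained by choosing a nonempty subset of each stratum in
  \<open>\<tau>\<close> (\<open>faces_over_essential_face\<close>). With \<open>w = 1 / (1 - t)\<close> one has
  \<open>1 + t / (1 - t) = w\<close>, so a stratum of size \<open>s\<close> contributes the factor
  \<open>w\<^sup>s - 1 = w\<^sup>s (1 - (1 - t)\<^sup>s)\<close>. The product of these factors over \<open>\<tau>\<close> only
  depends on the type \<open>m\<close> of \<open>\<tau>\<close> and contains \<open>w\<close> to the power \<open>\<mu>(m)\<close>; collecting
  the essential faces by type gives \<open>sum_faces_by_type\<close>. Multiplying numerator and denominator
  by \<open>(1 - t)\<^sup>N\<close>, which is possible for every \<open>N\<close>, gives the stated form with
  \<open>N = d + e\<close>. The vertices that do not span a face, if there are any, form a stratum of their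
  own, which belongs to no essential face and therefore does not contribute.
\<close>

section \<open>The face ideal and the monomial basis\<close>

text \<open>The exponent vectors of degree \<open>j\<close> with support exactly \<open>\<sigma>\<close>.\<close>

definition exponents_on :: "'v set \<Rightarrow> nat \<Rightarrow> ('v \<Rightarrow>\<^sub>0 nat) set" where
  "exponents_on \<sigma> j =
     {a. Poly_Mapping.keys a = \<sigma> \<and> (\<Sum>i\<in>Poly_Mapping.keys a. Poly_Mapping.lookup a i) = j}"

lemma keys_add_nat:
  "Poly_Mapping.keys (a + b) = Poly_Mapping.keys a \<union> Poly_Mapping.keys b"
  for a b :: "'v \<Rightarrow>\<^sub>0 nat"
  by (auto simp: in_keys_iff lookup_add)

lemma mpoly_ring_simps [simp]:
  "p \<in> carrier (mpoly_ring V) \<longleftrightarrow> (\<forall>a\<in>Poly_Mapping.keys p. Poly_Mapping.keys a \<subseteq> V)"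
  "p \<otimes>\<^bsub>mpoly_ring V\<^esub> q = p * q"
  "p \<oplus>\<^bsub>mpoly_ring V\<^esub> q = p + q"
  "\<one>\<^bsub>mpoly_ring V\<^esub> = 1"
  "\<zero>\<^bsub>mpoly_ring V\<^esub> = 0"
  by (simp_all add: mpoly_ring_def)

lemma mpoly_carrier_add:
  assumes "p \<in> carrier (mpoly_ring V)" "q \<in> carrier (mpoly_ring V)"
  shows "p + q \<in> carrier (mpoly_ring V)"
  using assms Poly_Mapping.keys_add[of p q] by auto

lemma mpoly_carrier_mult:
  assumes "p \<in> carrier (mpoly_ring V)" "q \<in> carrier (mpoly_ring V)"
  shows "p * q \<in> carrier (mpoly_ring V)"
  using assms keys_mult[of p q] by (fastforce simp: keys_add_nat)

lemma keys_uminus_mpoly: "Poly_Mapping.keys (- p) = Poly_Mapping.keys p"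
  for p :: "('v, 'k::field) mpoly"
  by (auto simp: in_keys_iff)

lemma cring_mpoly_ring: "cring (mpoly_ring V :: ('v, 'k::field) mpoly ring)"
proof (rule cringI)
  show "abelian_group (mpoly_ring V :: ('v, 'k::field) mpoly ring)"
  proof (rule abelian_groupI)
    fix x :: "('v, 'k) mpoly"
    assume "x \<in> carrier (mpoly_ring V)"
    then show "\<exists>y\<in>carrier (mpoly_ring V). y \<oplus>\<^bsub>mpoly_ring V\<^esub> x = \<zero>\<^bsub>mpoly_ring V\<^esub>"
      by (intro bexI[of _ "- x"]) (auto simp: keys_uminus_mpoly)
  qed (use mpoly_carrier_add[of _ V] in \<open>auto simp: algebra_simps simp del: mpoly_ring_simps(1)\<close>, auto)
  show "comm_monoid (mpoly_ring V :: ('v, 'k::field) mpoly ring)"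
    by (rule comm_monoidI)
      (use mpoly_carrier_mult[of _ V] in \<open>auto simp: algebra_simps simp del: mpoly_ring_simps(1)\<close>, auto)
qed (simp add: algebra_simps)

lemma mpoly_minus:
  assumes "p \<in> carrier (mpoly_ring V)" "q \<in> carrier (mpoly_ring V)"
  shows "p \<ominus>\<^bsub>mpoly_ring V\<^esub> q = p - (q :: ('v, 'k::field) mpoly)"
proof -
  interpret cring "mpoly_ring V :: ('v, 'k) mpoly ring" by (rule cring_mpoly_ring)
  have "\<ominus>\<^bsub>mpoly_ring V\<^esub> q = - q"
    using assms by (intro minus_equality) (auto simp: keys_uminus_mpoly)
  then show ?thesis by (simp add: a_minus_def)
qed

lemma mpoly_sum_terms:
  "p = (\<Sum>a\<in>Poly_Mapping.keys p. Poly_Mapping.single a (Poly_Mapping.lookup p a))"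
  for p :: "('v, 'k::field) mpoly"
  by (rule poly_mapping_eqI) (auto simp: lookup_sum lookup_single when_def in_keys_iff)

lemma prod_mpoly_var:
  assumes "finite \<sigma>"
  shows "(\<Prod>i\<in>\<sigma>. mpoly_var i :: ('v, 'k::field) mpoly) =
         Poly_Mapping.single (\<Sum>i\<in>\<sigma>. Poly_Mapping.single i 1) 1"
  using assms by induction (simp_all add: mpoly_var_def mult_single)

lemma keys_sum_single:
  assumes "finite \<sigma>"
  shows "Poly_Mapping.keys (\<Sum>i\<in>\<sigma>. Poly_Mapping.single i (1::nat)) = \<sigma>"
  using assms by induction (simp_all add: keys_add_nat)

lemma lookup_sum_single:
  assumes "finite \<sigma>"
  shows "Poly_Mapping.lookup (\<Sum>i\<in>\<sigma>. Poly_Mapping.single i (1::nat)) v = (if v \<in> \<sigma> then 1 else 0)"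
  using assms by (auto simp: lookup_sum lookup_single when_def)

text \<open>The face ideal is spanned by the monomials supported on nonfaces.\<close>

lemma SR_ideal_eq:
  assumes \<Delta>: "simplicial_complex V \<Delta>" and V: "finite V"
  shows "(SR_ideal V \<Delta> :: ('v, 'k::field) mpoly set) =
         {p \<in> carrier (mpoly_ring V). \<forall>a\<in>Poly_Mapping.keys p. Poly_Mapping.keys a \<notin> \<Delta>}"
    (is "_ = ?I")
    and "ideal (SR_ideal V \<Delta> :: ('v, 'k::field) mpoly set) (mpoly_ring V)"
proof -
  let ?R = "mpoly_ring V :: ('v, 'k) mpoly ring"
  let ?G = "{\<Prod>i\<in>\<sigma>. mpoly_var i | \<sigma>. \<sigma> \<subseteq> V \<and> \<sigma> \<notin> \<Delta>} :: ('v, 'k) mpoly set"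
  interpret R: cring ?R by (rule cring_mpoly_ring)
  have fin: "finite \<sigma>" if "\<sigma> \<subseteq> V" for \<sigma> using that V finite_subset by blast
  have GI: "?G \<subseteq> ?I"
    using fin by (auto simp: prod_mpoly_var keys_sum_single simp del: One_nat_def)
  then have Gc: "?G \<subseteq> carrier ?R" by blast
  have mult: "p * q \<in> ?I" if "p \<in> ?I" "q \<in> carrier ?R" for p q :: "('v, 'k) mpoly"
  proof -
    have "Poly_Mapping.keys c \<notin> \<Delta>" if c: "c \<in> Poly_Mapping.keys (p * q)" for c
    proof -
      obtain a b where "c = a + b" "a \<in> Poly_Mapping.keys p"
        using c keys_mult[of p q] by blast
      then show ?thesis
        using \<open>p \<in> ?I\<close> \<Delta> unfolding simplicial_complex_def by (auto simp: keys_add_nat)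
    qed
    then show ?thesis using that mpoly_carrier_mult[of p V q] by blast
  qed
  have "ideal ?I ?R"
  proof (rule idealI)
    show "subgroup ?I (add_monoid ?R)"
    proof (rule R.add.subgroupI)
      fix p q assume p: "p \<in> ?I" and q: "q \<in> ?I"
      have "\<ominus>\<^bsub>?R\<^esub> p = - p"
        using p by (intro R.minus_equality) (auto simp: keys_uminus_mpoly)
      with p show "\<ominus>\<^bsub>?R\<^esub> p \<in> ?I" by (simp add: keys_uminus_mpoly)
      show "p \<oplus>\<^bsub>?R\<^esub> q \<in> ?I"
        using p q mpoly_carrier_add[of p V q] Poly_Mapping.keys_add[of p q] by auto
    next
      have "0 \<in> ?I" by simp
      then show "?I \<noteq> {}" by blast
    qed auto
  next
    fix p q :: "('v, 'k) mpoly" assume "p \<in> ?I" "q \<in> carrier ?R"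
    then show "p \<otimes>\<^bsub>?R\<^esub> q \<in> ?I" "q \<otimes>\<^bsub>?R\<^esub> p \<in> ?I"
      using mult[of p q] by (simp_all add: mult.commute)
  qed (rule R.ring_axioms)
  then have le: "SR_ideal V \<Delta> \<subseteq> ?I"
    unfolding SR_ideal_def using GI by (rule R.genideal_minimal)
  have id: "ideal (SR_ideal V \<Delta>) ?R"
    unfolding SR_ideal_def using Gc by (rule R.genideal_ideal)
  then show "ideal (SR_ideal V \<Delta> :: ('v, 'k) mpoly set) (mpoly_ring V)" .
  interpret J: ideal "SR_ideal V \<Delta>" ?R by (rule id)
  have gens: "?G \<subseteq> SR_ideal V \<Delta>"
    unfolding SR_ideal_def using Gc by (rule R.genideal_self)
  have term_in: "Poly_Mapping.single a c \<in> SR_ideal V \<Delta>"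
    if "Poly_Mapping.keys a \<subseteq> V" "Poly_Mapping.keys a \<notin> \<Delta>" for a and c :: 'k
  proof -
    \<comment> \<open>The exponent of the generator for the support of \<open>a\<close>, which divides the monomial of \<open>a\<close>.\<close>
    let ?e = "\<Sum>i\<in>Poly_Mapping.keys a. Poly_Mapping.single i (1::nat)"
    have a: "(a - ?e) + ?e = a"
      by (rule poly_mapping_eqI)
        (auto simp: lookup_add lookup_minus lookup_sum_single in_keys_iff simp del: One_nat_def)
    have "(\<Prod>i\<in>Poly_Mapping.keys a. mpoly_var i) \<in> (SR_ideal V \<Delta> :: ('v, 'k) mpoly set)"
      using that gens by blast
    moreover have "Poly_Mapping.keys (a - ?e) \<subseteq> Poly_Mapping.keys a"
      by (auto simp: in_keys_iff lookup_minus)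
    then have "Poly_Mapping.single (a - ?e) c \<in> carrier ?R"
      using that by auto
    ultimately have "Poly_Mapping.single (a - ?e) c * (\<Prod>i\<in>Poly_Mapping.keys a. mpoly_var i)
        \<in> SR_ideal V \<Delta>"
      using J.I_l_closed by (simp del: mpoly_ring_simps(1))
    then show ?thesis
      by (simp add: prod_mpoly_var mult_single a del: One_nat_def)
  qed
  have sum_in: "sum f A \<in> SR_ideal V \<Delta>" if "finite A" "\<And>a. a \<in> A \<Longrightarrow> f a \<in> SR_ideal V \<Delta>"
    for f :: "('v \<Rightarrow>\<^sub>0 nat) \<Rightarrow> ('v, 'k) mpoly" and A
    using that
  proof induction
    case empty
    then show ?case using J.zero_closed by simp
  next
    case (insert a A)
    then show ?case using J.a_closed[of "f a" "sum f A"] by simp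
  qed
  have "?I \<subseteq> SR_ideal V \<Delta>"
  proof
    fix p assume p: "p \<in> ?I"
    have "(\<Sum>a\<in>Poly_Mapping.keys p. Poly_Mapping.single a (Poly_Mapping.lookup p a)) \<in> SR_ideal V \<Delta>"
      using p by (intro sum_in term_in) auto
    then show "p \<in> SR_ideal V \<Delta>" by (simp flip: mpoly_sum_terms)
  qed
  with le show "SR_ideal V \<Delta> = ?I" by blast
qed

lemma SR_class_hom:
  assumes "simplicial_complex V \<Delta>" "finite V"
  shows "ring_hom_ring (mpoly_ring V) (SR_ring V \<Delta>) (SR_class V \<Delta> :: ('v, 'k::field) mpoly \<Rightarrow> _)"
proof -
  interpret ideal "SR_ideal V \<Delta> :: ('v, 'k) mpoly set" "mpoly_ring V"
    by (rule SR_ideal_eq(2)[OF assms])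
  show ?thesis
    using rcos_ring_hom_ring unfolding SR_ring_def SR_class_def[abs_def] .
qed

lemma SR_class_eq_iff:
  assumes "simplicial_complex V \<Delta>" "finite V"
    and "p \<in> carrier (mpoly_ring V)" "q \<in> carrier (mpoly_ring V)"
  shows "SR_class V \<Delta> p = SR_class V \<Delta> (q :: ('v, 'k::field) mpoly) \<longleftrightarrow> p - q \<in> SR_ideal V \<Delta>"
proof -
  interpret R: cring "mpoly_ring V :: ('v, 'k) mpoly ring" by (rule cring_mpoly_ring)
  show ?thesis
    using R.quotient_eq_iff_same_a_r_cos[OF SR_ideal_eq(2)[OF assms(1,2)] assms(3,4)]
    by (simp add: SR_class_def mpoly_minus[OF assms(3,4)])
qed

lemma subfield_mpoly_const:
  "subfield (range mpoly_const) (mpoly_ring V :: ('v, 'k::field) mpoly ring)"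
proof -
  let ?R = "mpoly_ring V :: ('v, 'k) mpoly ring"
  let ?K = "?R\<lparr>carrier := range mpoly_const\<rparr>"
  interpret R: cring ?R by (rule cring_mpoly_ring)
  have ops: "mpoly_const a + mpoly_const b = (mpoly_const (a + b) :: ('v, 'k) mpoly)"
    "mpoly_const a * mpoly_const b = (mpoly_const (a * b) :: ('v, 'k) mpoly)" for a b
    by (simp_all add: mpoly_const_def single_add mult_single)
  have units: "mpoly_const 0 = (0 :: ('v, 'k) mpoly)" "mpoly_const 1 = (1 :: ('v, 'k) mpoly)"
    by (simp_all add: mpoly_const_def)
  have "cring ?K"
  proof (rule cringI)
    show "abelian_group ?K"
    proof (rule abelian_groupI)
      fix x assume "x \<in> carrier ?K"
      then obtain a where a: "x = mpoly_const a" by auto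
      have "mpoly_const (- a) \<oplus>\<^bsub>?K\<^esub> x = \<zero>\<^bsub>?K\<^esub>"
        by (simp add: a ops units)
      then show "\<exists>y\<in>carrier ?K. y \<oplus>\<^bsub>?K\<^esub> x = \<zero>\<^bsub>?K\<^esub>" by auto
    qed (auto simp: ops algebra_simps simp flip: units)
    show "comm_monoid ?K"
      by (rule comm_monoidI) (auto simp: ops algebra_simps simp flip: units)
  qed (auto simp: algebra_simps)
  then interpret K: cring ?K .
  have "field ?K"
  proof (rule K.cring_fieldI2)
    fix x assume "x \<in> carrier ?K" "x \<noteq> \<zero>\<^bsub>?K\<^esub>"
    then obtain a where "x = mpoly_const a" "mpoly_const a \<noteq> (0 :: ('v, 'k) mpoly)" by auto
    then have a: "x = mpoly_const a" "a \<noteq> 0" using units(1) by auto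
    then have "x \<otimes>\<^bsub>?K\<^esub> mpoly_const (inverse a) = \<one>\<^bsub>?K\<^esub>"
      by (simp add: ops units)
    then show "\<exists>y\<in>carrier ?K. x \<otimes>\<^bsub>?K\<^esub> y = \<one>\<^bsub>?K\<^esub>" by auto
  qed simp
  moreover have "range mpoly_const \<subseteq> carrier ?R"
    by (auto simp: mpoly_const_def split: if_splits)
  ultimately show ?thesis by (rule R.subfield_iff(1))
qed

lemma subfield_SR_scalars:
  assumes "simplicial_complex V \<Delta>" "finite V"
  shows "subfield (SR_scalars V \<Delta>) (SR_ring V \<Delta> :: ('v, 'k::field) mpoly set ring)"
proof -
  interpret h: ring_hom_ring "mpoly_ring V" "SR_ring V \<Delta>" "SR_class V \<Delta> :: ('v, 'k) mpoly \<Rightarrow> _"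
    by (rule SR_class_hom[OF assms])
  have "SR_class V \<Delta> 1 \<noteq> SR_class V \<Delta> (0 :: ('v, 'k) mpoly)"
    using assms by (subst SR_class_eq_iff) (auto simp: SR_ideal_eq simplicial_complex_def)
  then have "\<one>\<^bsub>SR_ring V \<Delta> :: ('v, 'k) mpoly set ring\<^esub> \<noteq> \<zero>\<^bsub>SR_ring V \<Delta>\<^esub>"
    using h.hom_one h.hom_zero by simp
  from h.img_is_subfield(2)[OF subfield_mpoly_const this]
  show ?thesis by (simp add: SR_scalars_def image_image)
qed

text \<open>
  Monomials supported on faces stay linearly independent modulo the face ideal, because no
  exponent of an element of that ideal is supported on a face.
\<close>

lemma dimension_face_monomials:
  assumes \<Delta>: "simplicial_complex V \<Delta>" and V: "finite V"
    and "finite A" and "\<And>a. a \<in> A \<Longrightarrow> Poly_Mapping.keys a \<in> \<Delta>"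
  shows "ring.dimension (SR_ring V \<Delta> :: ('v, 'k::field) mpoly set ring) (card A) (SR_scalars V \<Delta>)
           (SR_class V \<Delta> ` {p. Poly_Mapping.keys p \<subseteq> A})"
  using assms(3,4)
proof induction
  interpret h: ring_hom_ring "mpoly_ring V" "SR_ring V \<Delta>" "SR_class V \<Delta> :: ('v, 'k) mpoly \<Rightarrow> _"
    by (rule SR_class_hom[OF \<Delta> V])
  {
    case empty
    have "{p :: ('v, 'k) mpoly. Poly_Mapping.keys p \<subseteq> {}} = {0}" by auto
    then show ?case
      using h.S.dimension.zero_dim[of "SR_scalars V \<Delta>"] h.hom_zero by simp
  next
    case (insert a A)
    let ?S = "SR_ring V \<Delta> :: ('v, 'k) mpoly set ring"
    let ?E = "SR_class V \<Delta> ` {p :: ('v, 'k) mpoly. Poly_Mapping.keys p \<subseteq> A}"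
    let ?x = "Poly_Mapping.single a 1 :: ('v, 'k) mpoly"
    have sub: "Poly_Mapping.keys b \<subseteq> V" if "b \<in> insert a A" for b
      using insert.prems[OF that] \<Delta> by (auto simp: simplicial_complex_def)
    have carr: "p \<in> carrier (mpoly_ring V)" if "Poly_Mapping.keys p \<subseteq> insert a A"
      for p :: "('v, 'k) mpoly"
      using that sub by auto
    have carr': "p \<in> carrier (mpoly_ring V)" if "Poly_Mapping.keys p \<subseteq> A"
      for p :: "('v, 'k) mpoly"
      using that carr by blast
    have x: "?x \<in> carrier (mpoly_ring V)" by (rule carr) simp
    have const: "mpoly_const c \<in> carrier (mpoly_ring V)" for c :: 'k
      by (simp add: mpoly_const_def)
    have const_x: "mpoly_const c * ?x = Poly_Mapping.single a c" for c
      by (simp add: mpoly_const_def mult_single)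
    have "SR_class V \<Delta> ?x \<notin> ?E"
    proof
      assume "SR_class V \<Delta> ?x \<in> ?E"
      then obtain p :: "('v, 'k) mpoly" where p: "Poly_Mapping.keys p \<subseteq> A"
        and eq: "SR_class V \<Delta> ?x = SR_class V \<Delta> p" by auto
      have "?x - p \<in> SR_ideal V \<Delta>"
        using eq SR_class_eq_iff[OF \<Delta> V x carr'[OF p]] by simp
      moreover have "a \<in> Poly_Mapping.keys (?x - p)"
        using p insert.hyps by (auto simp: in_keys_iff lookup_minus subset_iff)
      ultimately show False
        using insert.prems[of a] by (auto simp: SR_ideal_eq[OF \<Delta> V])
    qed
    then have "h.S.dimension (Suc (card A)) (SR_scalars V \<Delta>)
        (h.S.line_extension (SR_scalars V \<Delta>) (SR_class V \<Delta> ?x) ?E)"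
      using insert by (intro h.S.dimension.Suc_dim h.hom_closed[OF x]) auto
    moreover have "h.S.line_extension (SR_scalars V \<Delta>) (SR_class V \<Delta> ?x) ?E =
        SR_class V \<Delta> ` {p. Poly_Mapping.keys p \<subseteq> insert a A}" (is "?L = ?M")
    proof
      have hom: "SR_class V \<Delta> (mpoly_const c) \<otimes>\<^bsub>?S\<^esub> SR_class V \<Delta> ?x \<oplus>\<^bsub>?S\<^esub> SR_class V \<Delta> p =
          SR_class V \<Delta> (Poly_Mapping.single a c + p)"
        if "Poly_Mapping.keys p \<subseteq> A" for c p
        using h.hom_mult[OF const x, of c] h.hom_add[OF carr carr'[OF that], of "Poly_Mapping.single a c"]
        by (simp add: const_x)
      show "?L \<subseteq> ?M"
      proof
        fix u assume "u \<in> ?L"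
        then obtain c p where p: "Poly_Mapping.keys p \<subseteq> A"
          and u: "u = SR_class V \<Delta> (Poly_Mapping.single a c + p)"
          using hom by (auto simp: h.S.line_extension_mem_iff SR_scalars_def)
        have "Poly_Mapping.keys (Poly_Mapping.single a c + p) \<subseteq> insert a A"
          using p Poly_Mapping.keys_add[of "Poly_Mapping.single a c" p] by (auto split: if_splits)
        with u show "u \<in> ?M" by blast
      qed
      show "?M \<subseteq> ?L"
      proof
        fix u assume "u \<in> ?M"
        then obtain p where p: "Poly_Mapping.keys p \<subseteq> insert a A" and u: "u = SR_class V \<Delta> p"
          by blast
        let ?c = "Poly_Mapping.lookup p a"
        define q where "q = p - Poly_Mapping.single a ?c"
        have q: "Poly_Mapping.keys q \<subseteq> A"
        proof
          fix b assume b: "b \<in> Poly_Mapping.keys q"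
          then have "b \<noteq> a" by (auto simp: q_def in_keys_iff lookup_minus)
          with b have "b \<in> Poly_Mapping.keys p"
            by (simp add: q_def in_keys_iff lookup_minus lookup_single)
          with p \<open>b \<noteq> a\<close> show "b \<in> A" by blast
        qed
        have "u = SR_class V \<Delta> (Poly_Mapping.single a ?c + q)" by (simp add: u q_def)
        then show "u \<in> ?L"
          using hom[OF q, of ?c] q
          by (auto simp: h.S.line_extension_mem_iff SR_scalars_def)
      qed
    qed
    ultimately show ?case using insert.hyps by simp
  }
qed

lemma finite_exponents_on:
  assumes "finite \<sigma>"
  shows "finite (exponents_on \<sigma> j)"
proof -
  let ?F = "{f. \<forall>i. (i \<in> \<sigma> \<longrightarrow> f i \<in> {..j}) \<and> (i \<notin> \<sigma> \<longrightarrow> f i = 0)}"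
  have "Poly_Mapping.lookup ` exponents_on \<sigma> j \<subseteq> ?F"
  proof (clarsimp simp: exponents_on_def, intro conjI impI)
    fix a :: "'a \<Rightarrow>\<^sub>0 nat" and i assume "i \<in> Poly_Mapping.keys a"
    then show "Poly_Mapping.lookup a i \<le> sum (Poly_Mapping.lookup a) (Poly_Mapping.keys a)"
      by (intro member_le_sum) auto
  qed (simp add: in_keys_iff)
  moreover have "finite ?F" using assms by (intro finite_set_of_finite_funs) auto
  ultimately have "finite (Poly_Mapping.lookup ` exponents_on \<sigma> j)" by (rule finite_subset)
  then show ?thesis by (rule finite_imageD) (simp add: inj_on_def poly_mapping_eqI)
qed

lemma dim_SR_graded_part:
  assumes \<Delta>: "simplicial_complex V \<Delta>" and V: "finite V"
  shows "ring.dim (SR_ring V \<Delta> :: ('v, 'k::field) mpoly set ring)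
           (SR_scalars V \<Delta>) (SR_graded_part V \<Delta> j) = (\<Sum>\<sigma>\<in>\<Delta>. card (exponents_on \<sigma> j))"
proof -
  interpret h: ring_hom_ring "mpoly_ring V" "SR_ring V \<Delta>" "SR_class V \<Delta> :: ('v, 'k) mpoly \<Rightarrow> _"
    by (rule SR_class_hom[OF \<Delta> V])
  define A where "A = (\<Union>\<sigma>\<in>\<Delta>. exponents_on \<sigma> j)"
  have \<Delta>V: "\<Delta> \<subseteq> Pow V" using \<Delta> by (simp add: simplicial_complex_def)
  then have fin\<Delta>: "finite \<Delta>" using V finite_subset by blast
  have fin: "finite \<sigma>" if "\<sigma> \<in> \<Delta>" for \<sigma> using that \<Delta>V V finite_subset by blast
  have "finite A" using fin\<Delta> fin by (auto simp: A_def intro: finite_exponents_on)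
  have A: "a \<in> A \<longleftrightarrow> Poly_Mapping.keys a \<in> \<Delta> \<and>
      (\<Sum>i\<in>Poly_Mapping.keys a. Poly_Mapping.lookup a i) = j" for a
    by (auto simp: A_def exponents_on_def)
  have "SR_graded_part V \<Delta> j = SR_class V \<Delta> ` {p :: ('v, 'k) mpoly. Poly_Mapping.keys p \<subseteq> A}"
  proof
    show "SR_class V \<Delta> ` {p :: ('v, 'k) mpoly. Poly_Mapping.keys p \<subseteq> A} \<subseteq> SR_graded_part V \<Delta> j"
    proof (clarsimp simp: SR_graded_part_def, rule imageI)
      fix p :: "('v, 'k) mpoly" assume "Poly_Mapping.keys p \<subseteq> A"
      then show "p \<in> {p. (\<forall>a\<in>Poly_Mapping.keys p. Poly_Mapping.keys a \<subseteq> V) \<and> homogeneous j p}"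
        using \<Delta>V by (fastforce simp: homogeneous_def A)
    qed
    show "SR_graded_part V \<Delta> j \<subseteq> SR_class V \<Delta> ` {p :: ('v, 'k) mpoly. Poly_Mapping.keys p \<subseteq> A}"
    proof
      fix u :: "('v, 'k) mpoly set" assume "u \<in> SR_graded_part V \<Delta> j"
      then obtain p where p: "p \<in> carrier (mpoly_ring V)" "homogeneous j p"
        and u: "u = SR_class V \<Delta> p" by (auto simp: SR_graded_part_def)
      \<comment> \<open>The terms of \<open>p\<close> that are supported on nonfaces vanish in the quotient.\<close>
      define q where "q = (\<Sum>a\<in>Poly_Mapping.keys p \<inter> A.
        Poly_Mapping.single a (Poly_Mapping.lookup p a))"
      have lookup_q: "Poly_Mapping.lookup q a = (if a \<in> A then Poly_Mapping.lookup p a else 0)" for a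
        by (auto simp: q_def lookup_sum lookup_single when_def in_keys_iff)
      have q: "Poly_Mapping.keys q \<subseteq> A" by (auto simp: in_keys_iff lookup_q split: if_splits)
      then have "q \<in> carrier (mpoly_ring V)" using \<Delta>V by (fastforce simp: A)
      moreover have "p - q \<in> SR_ideal V \<Delta>"
      proof -
        have "Poly_Mapping.keys a \<subseteq> V \<and> Poly_Mapping.keys a \<notin> \<Delta>"
          if "a \<in> Poly_Mapping.keys (p - q)" for a
        proof -
          have "a \<in> Poly_Mapping.keys p" "a \<notin> A"
            using that by (auto simp: in_keys_iff lookup_minus lookup_q split: if_splits)
          then show ?thesis using p by (auto simp: A homogeneous_def)
        qed
        then show ?thesis by (auto simp: SR_ideal_eq[OF \<Delta> V])
      qed
      ultimately have "u = SR_class V \<Delta> q"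
        using SR_class_eq_iff[OF \<Delta> V p(1)] u by blast
      with q show "u \<in> SR_class V \<Delta> ` {p. Poly_Mapping.keys p \<subseteq> A}" by blast
    qed
  qed
  moreover have "h.S.dimension (card A) (SR_scalars V \<Delta>)
      (SR_class V \<Delta> ` {p :: ('v, 'k) mpoly. Poly_Mapping.keys p \<subseteq> A})"
    using \<open>finite A\<close> by (intro dimension_face_monomials[OF \<Delta> V]) (auto simp: A)
  ultimately have "h.S.dim (SR_scalars V \<Delta>) (SR_graded_part V \<Delta> j) = card A"
    using h.S.dimI[OF subfield_SR_scalars[OF \<Delta> V]] by (simp add: over_def)
  also have "card A = (\<Sum>\<sigma>\<in>\<Delta>. card (exponents_on \<sigma> j))"
    unfolding A_def using fin\<Delta> fin
    by (intro card_UN_disjoint ballI finite_exponents_on) (auto simp: exponents_on_def)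
  finally show ?thesis .
qed

section \<open>The Hilbert series as a sum over faces\<close>

lemma fps_geometric:
  "inverse (1 - fps_X) * (1 - fps_X) = (1 :: rat fps)"
  "fps_X * inverse (1 - fps_X) = Abs_fps (\<lambda>i. if i = 0 then 0 else 1 :: rat)" (is "_ = ?g")
  "inverse (1 - fps_X) = (1 + fps_X * inverse (1 - fps_X) :: rat fps)"
proof -
  let ?w = "inverse (1 - fps_X) :: rat fps"
  show w: "?w * (1 - fps_X) = 1" by (rule inverse_mult_eq_1) simp
  have "?g * (1 - fps_X) = fps_X"
  proof (rule fps_ext)
    fix n show "fps_nth (?g * (1 - fps_X)) n = fps_nth fps_X n"
      by (cases n) (auto simp: right_diff_distrib)
  qed
  then have "fps_X * ?w = ?g * (1 - fps_X) * ?w" by (simp only:)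
  also have "\<dots> = ?g * (?w * (1 - fps_X))" by (simp only: mult_ac)
  finally show "fps_X * ?w = ?g" by (simp only: w mult_1_right)
  have "?w * ((1 - fps_X) + fps_X) = ?w * (1 - fps_X) + ?w * fps_X" by (rule distrib_left)
  then show "?w = 1 + fps_X * ?w" by (simp only: w diff_add_cancel mult_1_right mult.commute[of ?w fps_X])
qed

text \<open>The exponent \<open>i \<ge> 1\<close> of the new variable \<open>v\<close> is split off.\<close>

lemma card_exponents_on_insert:
  assumes \<sigma>: "finite \<sigma>" "v \<notin> \<sigma>"
  shows "card (exponents_on (insert v \<sigma>) j) = (\<Sum>i=1..j. card (exponents_on \<sigma> (j - i)))"
proof -
  let ?S = "SIGMA i:{1..j}. exponents_on \<sigma> (j - i)"
  let ?f = "\<lambda>(i, a). a + Poly_Mapping.single v i"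
  let ?deg = "\<lambda>a :: 'a \<Rightarrow>\<^sub>0 nat. \<Sum>i\<in>Poly_Mapping.keys a. Poly_Mapping.lookup a i"
  have zero: "Poly_Mapping.lookup a v = 0" if "Poly_Mapping.keys a = \<sigma>" for a :: "'a \<Rightarrow>\<^sub>0 nat"
    using that \<sigma> by (auto simp: in_keys_iff)
  have keys: "Poly_Mapping.keys (a + Poly_Mapping.single v i) = insert v \<sigma>"
    if "Poly_Mapping.keys a = \<sigma>" "i \<noteq> 0" for a :: "'a \<Rightarrow>\<^sub>0 nat" and i
    using that by (simp add: keys_add_nat)
  have deg: "?deg (a + Poly_Mapping.single v i) = ?deg a + i"
    if "Poly_Mapping.keys a = \<sigma>" "i \<noteq> 0" for a :: "'a \<Rightarrow>\<^sub>0 nat" and i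
  proof -
    have "?deg (a + Poly_Mapping.single v i) =
        (\<Sum>k\<in>insert v \<sigma>. Poly_Mapping.lookup a k + Poly_Mapping.lookup (Poly_Mapping.single v i) k)"
      by (simp only: keys[OF that] lookup_add)
    also have "\<dots> = i + (\<Sum>k\<in>\<sigma>. Poly_Mapping.lookup a k + Poly_Mapping.lookup (Poly_Mapping.single v i) k)"
      using \<sigma> zero[OF that(1)] by simp
    also have "(\<Sum>k\<in>\<sigma>. Poly_Mapping.lookup a k + Poly_Mapping.lookup (Poly_Mapping.single v i) k) =
        (\<Sum>k\<in>\<sigma>. Poly_Mapping.lookup a k)"
      using \<sigma> by (intro sum.cong) (auto simp: lookup_single when_def)
    finally show ?thesis using that by simp
  qed
  have "bij_betw ?f ?S (exponents_on (insert v \<sigma>) j)"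
    unfolding bij_betw_def
  proof
    show "inj_on ?f ?S"
    proof (rule inj_onI, clarsimp simp: exponents_on_def)
      fix a b :: "'a \<Rightarrow>\<^sub>0 nat" and i k
      assume *: "Poly_Mapping.keys b = Poly_Mapping.keys a" "\<sigma> = Poly_Mapping.keys a"
        and eq: "a + Poly_Mapping.single v i = b + Poly_Mapping.single v k"
      have "Poly_Mapping.lookup (a + Poly_Mapping.single v i) v =
          Poly_Mapping.lookup (b + Poly_Mapping.single v k) v"
        by (simp only: eq)
      then have "i = k" using * zero[of a] zero[of b] by (simp add: lookup_add)
      with eq show "i = k \<and> a = b" by simp
    qed
    show "?f ` ?S = exponents_on (insert v \<sigma>) j"
    proof
      show "?f ` ?S \<subseteq> exponents_on (insert v \<sigma>) j"
        using keys deg by (auto simp: exponents_on_def simp del: One_nat_def)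
      show "exponents_on (insert v \<sigma>) j \<subseteq> ?f ` ?S"
      proof
        fix c assume c: "c \<in> exponents_on (insert v \<sigma>) j"
        define i where "i = Poly_Mapping.lookup c v"
        define a where "a = c - Poly_Mapping.single v i"
        have i: "i \<noteq> 0" using c by (auto simp: i_def exponents_on_def in_keys_iff)
        have ca: "c = a + Poly_Mapping.single v i"
          by (rule poly_mapping_eqI) (auto simp: a_def i_def lookup_add lookup_minus lookup_single when_def)
        have "Poly_Mapping.lookup a x = (if x = v then 0 else Poly_Mapping.lookup c x)" for x
          by (simp add: a_def i_def lookup_minus lookup_single when_def)
        then have "Poly_Mapping.keys a = Poly_Mapping.keys c - {v}"
          by (auto simp: in_keys_iff split: if_splits)
        then have a: "Poly_Mapping.keys a = \<sigma>"
          using c \<sigma> by (simp add: exponents_on_def)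
        have "?deg a + i = j" using deg[OF a i] c by (simp add: ca exponents_on_def)
        then have "(i, a) \<in> ?S" using a i by (auto simp: exponents_on_def)
        then show "c \<in> ?f ` ?S" using ca by (intro image_eqI[of _ _ "(i, a)"]) simp_all
      qed
    qed
  qed
  then have "card (exponents_on (insert v \<sigma>) j) = card ?S" by (simp add: bij_betw_same_card)
  also have "\<dots> = (\<Sum>i=1..j. card (exponents_on \<sigma> (j - i)))"
    using \<sigma> by (simp add: card_SigmaI finite_exponents_on)
  finally show ?thesis .
qed

text \<open>Each of the variables of \<open>\<sigma>\<close> contributes a factor \<open>t + t\<^sup>2 + \<dots> = t / (1 - t)\<close>.\<close>

lemma fps_exponents_on:
  fixes \<sigma> :: "'v set"
  assumes "finite \<sigma>"
  shows "Abs_fps (\<lambda>j. of_nat (card (exponents_on \<sigma> j))) =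
         (fps_X * inverse (1 - fps_X) :: rat fps) ^ card \<sigma>"
  using assms
proof induction
  case empty
  have "exponents_on ({} :: 'v set) j = (if j = 0 then {0} else {})" for j
    by (auto simp: exponents_on_def)
  then show ?case by (auto simp: fps_eq_iff)
next
  case (insert v \<sigma>)
  let ?G = "\<lambda>\<sigma>. Abs_fps (\<lambda>j. of_nat (card (exponents_on \<sigma> j))) :: rat fps"
  have "?G (insert v \<sigma>) = fps_X * inverse (1 - fps_X) * ?G \<sigma>"
  proof (rule fps_ext)
    fix j
    have "fps_nth (fps_X * inverse (1 - fps_X) * ?G \<sigma>) j =
        (\<Sum>i=0..j. (if i = 0 then 0 else 1) * of_nat (card (exponents_on \<sigma> (j - i))))"
      unfolding fps_geometric(2) by (simp add: fps_mult_nth)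
    also have "\<dots> = (\<Sum>i=1..j. of_nat (card (exponents_on \<sigma> (j - i))))"
      by (intro sum.mono_neutral_cong_right) auto
    finally show "fps_nth (?G (insert v \<sigma>)) j = fps_nth (fps_X * inverse (1 - fps_X) * ?G \<sigma>) j"
      by (simp only: fps_nth_Abs_fps card_exponents_on_insert[OF insert.hyps] of_nat_sum)
  qed
  also have "\<dots> = (fps_X * inverse (1 - fps_X)) ^ Suc (card \<sigma>)"
    by (simp only: insert.IH power_Suc)
  finally show ?case by (simp only: card_insert_disjoint[OF insert.hyps])
qed

lemma hilbert_series_eq_sum_faces:
  assumes \<Delta>: "simplicial_complex V \<Delta>" and V: "finite V"
  shows "hilbert_series TYPE('k::field) V \<Delta> =
         (\<Sum>\<sigma>\<in>\<Delta>. (fps_X * inverse (1 - fps_X)) ^ card \<sigma>)"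
proof -
  have fin: "finite \<sigma>" if "\<sigma> \<in> \<Delta>" for \<sigma>
    using \<Delta> that by (intro finite_subset[OF _ V]) (auto simp: simplicial_complex_def)
  have "hilbert_series TYPE('k) V \<Delta> =
      (\<Sum>\<sigma>\<in>\<Delta>. Abs_fps (\<lambda>j. of_nat (card (exponents_on \<sigma> j))))"
    by (rule fps_ext) (simp add: hilbert_series_def dim_SR_graded_part[OF \<Delta> V] fps_sum_nth)
  also have "\<dots> = (\<Sum>\<sigma>\<in>\<Delta>. (fps_X * inverse (1 - fps_X)) ^ card \<sigma>)"
    by (intro sum.cong refl fps_exponents_on fin)
  finally show ?thesis .
qed

lemma sum_faces_by_dimension:
  fixes u w x :: "'a::comm_ring_1"
  assumes \<Delta>: "simplicial_complex V \<Delta>" and V: "finite V" and w: "w * u = 1"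
  defines "d \<equiv> nat (complex_dim \<Delta> + 1)"
  shows "(\<Sum>\<sigma>\<in>\<Delta>. (x * w) ^ card \<sigma>) =
         w ^ d * (\<Sum>i=0..d. of_nat (face_number \<Delta> (int i - 1)) * u ^ (d - i) * x ^ i)"
proof -
  have fin: "finite \<Delta>"
    using \<Delta> V finite_subset[of \<Delta> "Pow V"] by (simp add: simplicial_complex_def)
  have le: "card \<sigma> \<le> d" if "\<sigma> \<in> \<Delta>" for \<sigma>
  proof -
    have "face_dim \<sigma> \<le> complex_dim \<Delta>"
      unfolding complex_dim_def using fin that by (intro Max_ge) auto
    then show ?thesis by (simp add: face_dim_def d_def)
  qed
  have "(\<Sum>\<sigma>\<in>\<Delta>. (x * w) ^ card \<sigma>) = (\<Sum>i=0..d. \<Sum>\<sigma>\<in>{\<sigma> \<in> \<Delta>. card \<sigma> = i}. (x * w) ^ card \<sigma>)"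
    using fin le by (intro sum.group[symmetric]) auto
  also have "\<dots> = (\<Sum>i=0..d. w ^ d * (of_nat (face_number \<Delta> (int i - 1)) * u ^ (d - i) * x ^ i))"
  proof (rule sum.cong)
    fix i assume "i \<in> {0..d}"
    then have "w ^ d = w ^ i * w ^ (d - i)" by (simp flip: power_add)
    then have w_pow: "w ^ d * u ^ (d - i) = w ^ i"
      using w by (simp add: mult.assoc flip: power_mult_distrib)
    have "(\<Sum>\<sigma>\<in>{\<sigma> \<in> \<Delta>. card \<sigma> = i}. (x * w) ^ card \<sigma>) = of_nat (face_number \<Delta> (int i - 1)) * (x * w) ^ i"
      by (simp add: face_number_def face_dim_def)
    also have "\<dots> = w ^ d * (of_nat (face_number \<Delta> (int i - 1)) * u ^ (d - i) * x ^ i)"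
      by (simp only: power_mult_distrib w_pow[symmetric] mult_ac)
    finally show "(\<Sum>\<sigma>\<in>{\<sigma> \<in> \<Delta>. card \<sigma> = i}. (x * w) ^ card \<sigma>) =
        w ^ d * (of_nat (face_number \<Delta> (int i - 1)) * u ^ (d - i) * x ^ i)" .
  qed simp
  finally show ?thesis by (simp add: sum_distrib_left)
qed

section \<open>Strata and essential faces\<close>

text \<open>The stratum of a vertex consists of the vertices that lie in the same facets.\<close>

lemma mem_stratum_iff:
  assumes L: "L \<subseteq> facets \<Delta>" and v: "v \<in> stratum V \<Delta> L"
  shows "w \<in> stratum V \<Delta> L \<longleftrightarrow> w \<in> V \<and> (\<forall>F\<in>facets \<Delta>. v \<in> F \<longleftrightarrow> w \<in> F)"
proof -
  have char: "w \<in> stratum V \<Delta> L \<longleftrightarrow>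
      w \<in> V \<and> (\<forall>F\<in>facets \<Delta>. w \<in> F \<longleftrightarrow> facet_inter V L \<subseteq> F)" for w
  proof
    assume "w \<in> stratum V \<Delta> L"
    then show "w \<in> V \<and> (\<forall>F\<in>facets \<Delta>. w \<in> F \<longleftrightarrow> facet_inter V L \<subseteq> F)"
      by (auto simp: stratum_def facet_inter_def)
  next
    assume w: "w \<in> V \<and> (\<forall>F\<in>facets \<Delta>. w \<in> F \<longleftrightarrow> facet_inter V L \<subseteq> F)"
    moreover have "facet_inter V L \<subseteq> F" if "F \<in> L" for F
      using that by (auto simp: facet_inter_def)
    ultimately have "w \<in> facet_inter V L" using L by (auto simp: facet_inter_def)
    with w show "w \<in> stratum V \<Delta> L" by (auto simp: stratum_def)
  qed
  show ?thesis using char[of v] char[of w] v by blast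
qed

lemma strata_cover:
  assumes "v \<in> V"
  shows "\<exists>\<omega>\<in>strata V \<Delta>. v \<in> \<omega>"
proof -
  let ?L = "{F \<in> facets \<Delta>. v \<in> F}"
  have "v \<in> stratum V \<Delta> ?L"
    using assms by (auto simp: stratum_def facet_inter_def)
  then show ?thesis unfolding strata_def by blast
qed

lemma mem_strata_iff:
  assumes "\<omega> \<in> strata V \<Delta>" "v \<in> \<omega>"
  shows "w \<in> \<omega> \<longleftrightarrow> w \<in> V \<and> (\<forall>F\<in>facets \<Delta>. v \<in> F \<longleftrightarrow> w \<in> F)"
proof -
  obtain L where L: "L \<subseteq> facets \<Delta>" "\<omega> = stratum V \<Delta> L"
    using assms(1) by (auto simp: strata_def)
  with assms(2) show ?thesis using mem_stratum_iff[of L \<Delta> v V w] by simp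
qed

lemma strata_disjoint:
  assumes "\<omega> \<in> strata V \<Delta>" "\<omega>' \<in> strata V \<Delta>" "v \<in> \<omega>" "v \<in> \<omega>'"
  shows "\<omega> = \<omega>'"
  using mem_strata_iff[OF assms(1,3)] mem_strata_iff[OF assms(2,4)] by blast

lemma strata_subset: "\<omega> \<in> strata V \<Delta> \<Longrightarrow> \<omega> \<subseteq> V"
  by (auto simp: strata_def stratum_def facet_inter_def)

lemma face_subset_facet:
  assumes \<Delta>: "simplicial_complex V \<Delta>" and V: "finite V" and "\<sigma> \<in> \<Delta>"
  obtains F where "F \<in> facets \<Delta>" "\<sigma> \<subseteq> F"
proof -
  have "finite \<Delta>"
    using \<Delta> V finite_subset[of \<Delta> "Pow V"] by (simp add: simplicial_complex_def)
  then obtain F where "F \<in> \<Delta>" "\<sigma> \<subseteq> F" "\<forall>G\<in>\<Delta>. F \<subseteq> G \<longrightarrow> F = G"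
    using finite_has_maximal2[of \<Delta> \<sigma>] \<open>\<sigma> \<in> \<Delta>\<close> by blast
  then show ?thesis using that[of F] by (auto simp: facets_def)
qed

text \<open>A facet that meets a stratum contains it; hence a face may be enlarged to the union of
  all strata that it meets.\<close>

lemma Union_essential_face_in_complex:
  assumes \<Delta>: "simplicial_complex V \<Delta>" and V: "finite V" and "\<sigma> \<in> \<Delta>"
  shows "\<Union>(essential_face V \<Delta> \<sigma>) \<in> \<Delta>"
proof -
  obtain F where F: "F \<in> facets \<Delta>" "\<sigma> \<subseteq> F" by (rule face_subset_facet[OF assms])
  have "\<omega> \<subseteq> F" if \<omega>: "\<omega> \<in> essential_face V \<Delta> \<sigma>" for \<omega>
  proof -
    obtain v where "v \<in> \<sigma>" "v \<in> \<omega>" "\<omega> \<in> strata V \<Delta>"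
      using \<omega> unfolding essential_face_def by blast
    then show ?thesis using mem_strata_iff[of \<omega> V \<Delta> v] F by blast
  qed
  moreover have "F \<in> \<Delta>" using F by (simp add: facets_def)
  ultimately show ?thesis using \<Delta> by (auto simp: simplicial_complex_def Sup_le_iff)
qed

text \<open>
  All faces with essential face \<open>\<tau>\<close> arise by choosing, independently of each other, a nonempty
  subset of every stratum in \<open>\<tau>\<close>.
\<close>

lemma faces_over_essential_face:
  assumes \<Delta>: "simplicial_complex V \<Delta>" and V: "finite V" and \<tau>: "\<tau> \<in> essential_complex V \<Delta>"
  shows "{\<sigma> \<in> \<Delta>. essential_face V \<Delta> \<sigma> = \<tau>} = {\<sigma>. \<sigma> \<subseteq> \<Union>\<tau> \<and> (\<forall>\<omega>\<in>\<tau>. \<sigma> \<inter> \<omega> \<noteq> {})}"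
proof (rule subset_antisym; rule subsetI)
  fix \<sigma> assume "\<sigma> \<in> {\<sigma> \<in> \<Delta>. essential_face V \<Delta> \<sigma> = \<tau>}"
  then have \<sigma>: "\<sigma> \<in> \<Delta>" "essential_face V \<Delta> \<sigma> = \<tau>" by auto
  then have "\<sigma> \<subseteq> V" using \<Delta> by (auto simp: simplicial_complex_def)
  then have "\<sigma> \<subseteq> \<Union>(essential_face V \<Delta> \<sigma>)"
    using strata_cover[of _ V \<Delta>] by (fastforce simp: essential_face_def)
  moreover have "\<forall>\<omega>\<in>essential_face V \<Delta> \<sigma>. \<sigma> \<inter> \<omega> \<noteq> {}"
    by (simp add: essential_face_def)
  ultimately show "\<sigma> \<in> {\<sigma>. \<sigma> \<subseteq> \<Union>\<tau> \<and> (\<forall>\<omega>\<in>\<tau>. \<sigma> \<inter> \<omega> \<noteq> {})}"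
    using \<sigma>(2) by simp
next
  fix \<sigma> assume "\<sigma> \<in> {\<sigma>. \<sigma> \<subseteq> \<Union>\<tau> \<and> (\<forall>\<omega>\<in>\<tau>. \<sigma> \<inter> \<omega> \<noteq> {})}"
  then have \<sigma>: "\<sigma> \<subseteq> \<Union>\<tau>" "\<forall>\<omega>\<in>\<tau>. \<sigma> \<inter> \<omega> \<noteq> {}" by auto
  obtain \<rho> where \<rho>: "\<rho> \<in> \<Delta>" "\<tau> = essential_face V \<Delta> \<rho>"
    using \<tau> by (auto simp: essential_complex_def)
  have \<tau>_strata: "\<tau> \<subseteq> strata V \<Delta>" by (auto simp: \<rho> essential_face_def)
  have "\<sigma> \<in> \<Delta>"
    using Union_essential_face_in_complex[OF \<Delta> V \<rho>(1)] \<Delta> \<sigma>(1) \<rho>(2)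
    by (auto simp: simplicial_complex_def)
  moreover have "essential_face V \<Delta> \<sigma> = \<tau>"
  proof
    show "\<tau> \<subseteq> essential_face V \<Delta> \<sigma>"
      using \<sigma>(2) \<tau>_strata by (auto simp: essential_face_def)
    show "essential_face V \<Delta> \<sigma> \<subseteq> \<tau>"
    proof
      fix \<omega> assume "\<omega> \<in> essential_face V \<Delta> \<sigma>"
      then obtain v where v: "v \<in> \<sigma>" "v \<in> \<omega>" "\<omega> \<in> strata V \<Delta>"
        unfolding essential_face_def by blast
      then obtain \<omega>' where "\<omega>' \<in> \<tau>" "v \<in> \<omega>'" using \<sigma>(1) by blast
      then show "\<omega> \<in> \<tau>" using strata_disjoint[of \<omega> V \<Delta> \<omega>' v] v \<tau>_strata by blast
    qed
  qed
  ultimately show "\<sigma> \<in> {\<sigma> \<in> \<Delta>. essential_face V \<Delta> \<sigma> = \<tau>}" by simp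
qed

section \<open>Summation over the faces by type\<close>

lemma sum_nonempty_subsets:
  fixes y :: "'a::comm_ring_1"
  assumes "finite A"
  shows "(\<Sum>\<rho>\<in>{\<rho>. \<rho> \<subseteq> A \<and> \<rho> \<noteq> {}}. y ^ card \<rho>) = (1 + y) ^ card A - 1"
proof -
  have "(1 + y) ^ card A = (\<Sum>\<rho>\<in>Pow A. y ^ card \<rho>)"
    using prod_add[OF assms, of "\<lambda>_. y" "\<lambda>_. 1"] by (simp add: add.commute)
  also have "\<dots> = (\<Sum>\<rho>\<in>insert {} {\<rho>. \<rho> \<subseteq> A \<and> \<rho> \<noteq> {}}. y ^ card \<rho>)"
    by (rule sum.cong) auto
  also have "\<dots> = 1 + (\<Sum>\<rho>\<in>{\<rho>. \<rho> \<subseteq> A \<and> \<rho> \<noteq> {}}. y ^ card \<rho>)"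
    using assms by (subst sum.insert) auto
  finally show ?thesis by simp
qed

lemma sum_sets_meeting_all_blocks:
  fixes y :: "'a::comm_ring_1"
  assumes "finite \<tau>" "pairwise disjnt \<tau>" "\<And>\<omega>. \<omega> \<in> \<tau> \<Longrightarrow> finite \<omega>"
  shows "(\<Sum>\<sigma>\<in>{\<sigma>. \<sigma> \<subseteq> \<Union>\<tau> \<and> (\<forall>\<omega>\<in>\<tau>. \<sigma> \<inter> \<omega> \<noteq> {})}. y ^ card \<sigma>) =
         (\<Prod>\<omega>\<in>\<tau>. (1 + y) ^ card \<omega> - 1)"
  using assms
proof induction
  case empty
  then show ?case by simp
next
  case (insert \<omega> \<tau>)
  let ?M = "\<lambda>\<tau>. {\<sigma>. \<sigma> \<subseteq> \<Union>\<tau> \<and> (\<forall>\<omega>\<in>\<tau>. \<sigma> \<inter> \<omega> \<noteq> {})}"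
  let ?N = "{\<rho>. \<rho> \<subseteq> \<omega> \<and> \<rho> \<noteq> {}}"
  have disj: "\<omega> \<inter> \<Union>\<tau> = {}"
    using insert.hyps insert.prems(1) by (auto simp: pairwise_def disjnt_def)
  have fin: "finite \<omega>" "finite (\<Union>\<tau>)" using insert by auto
  have IH: "(\<Sum>\<sigma>\<in>?M \<tau>. y ^ card \<sigma>) = (\<Prod>\<omega>\<in>\<tau>. (1 + y) ^ card \<omega> - 1)"
    using insert by (intro insert.IH) (auto simp: pairwise_def disjnt_def)
  have "(\<Sum>\<sigma>\<in>?M (insert \<omega> \<tau>). y ^ card \<sigma>) = (\<Sum>(\<rho>, \<sigma>)\<in>?N \<times> ?M \<tau>. y ^ card \<rho> * y ^ card \<sigma>)"
  proof (rule sum.reindex_bij_witness[where i = "\<lambda>(\<rho>, \<sigma>). \<rho> \<union> \<sigma>" and j = "\<lambda>\<sigma>. (\<sigma> \<inter> \<omega>, \<sigma> - \<omega>)"])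
    fix \<sigma> assume \<sigma>: "\<sigma> \<in> ?M (insert \<omega> \<tau>)"
    show "(case (\<sigma> \<inter> \<omega>, \<sigma> - \<omega>) of (\<rho>, \<sigma>) \<Rightarrow> \<rho> \<union> \<sigma>) = \<sigma>" by auto
    have "(\<sigma> - \<omega>) \<inter> \<omega>' \<noteq> {}" if "\<omega>' \<in> \<tau>" for \<omega>'
    proof -
      have "\<sigma> \<inter> \<omega>' \<noteq> {}" using \<sigma> that by auto
      with disj that show ?thesis by blast
    qed
    with \<sigma> show "(\<sigma> \<inter> \<omega>, \<sigma> - \<omega>) \<in> ?N \<times> ?M \<tau>" by auto
    have "finite \<sigma>" using \<sigma> fin by (auto intro: finite_subset)
    then have "card \<sigma> = card (\<sigma> \<inter> \<omega>) + card (\<sigma> - \<omega>)"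
      by (subst card_Un_disjoint[symmetric]) (auto intro!: arg_cong[where f = card])
    then show "(case (\<sigma> \<inter> \<omega>, \<sigma> - \<omega>) of (\<rho>, \<sigma>) \<Rightarrow> y ^ card \<rho> * y ^ card \<sigma>) = y ^ card \<sigma>"
      by (simp add: power_add)
  next
    fix p assume "p \<in> ?N \<times> ?M \<tau>"
    then obtain \<rho> \<sigma> where p: "p = (\<rho>, \<sigma>)" "\<rho> \<in> ?N" "\<sigma> \<in> ?M \<tau>" by auto
    then have \<sigma>: "\<sigma> \<inter> \<omega> = {}" "\<rho> \<subseteq> \<omega>" using disj by auto
    then have "(\<rho> \<union> \<sigma>) \<inter> \<omega> = \<rho>" "(\<rho> \<union> \<sigma>) - \<omega> = \<sigma>" by auto
    then show "((case p of (\<rho>, \<sigma>) \<Rightarrow> \<rho> \<union> \<sigma>) \<inter> \<omega>, (case p of (\<rho>, \<sigma>) \<Rightarrow> \<rho> \<union> \<sigma>) - \<omega>) = p"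
      by (simp add: p)
    have "(\<rho> \<union> \<sigma>) \<inter> \<omega>' \<noteq> {}" if "\<omega>' \<in> insert \<omega> \<tau>" for \<omega>'
      using that p by auto
    then show "(case p of (\<rho>, \<sigma>) \<Rightarrow> \<rho> \<union> \<sigma>) \<in> ?M (insert \<omega> \<tau>)"
      using p by auto
  qed
  also have "\<dots> = (\<Sum>\<rho>\<in>?N. y ^ card \<rho>) * (\<Sum>\<sigma>\<in>?M \<tau>. y ^ card \<sigma>)"
    by (simp add: sum_product sum.cartesian_product)
  also have "\<dots> = (\<Prod>\<omega>\<in>insert \<omega> \<tau>. (1 + y) ^ card \<omega> - 1)"
    using insert.hyps fin by (simp add: IH sum_nonempty_subsets)
  finally show ?case .
qed

lemma supp_face_type:
  assumes "finite \<tau>"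
  shows "supp (face_type \<tau>) = card ` \<tau>"
  using assms by (auto simp: supp_def face_type_def card_eq_0_iff)

text \<open>
  With \<open>w = 1 / u\<close>, the factors \<open>w\<^sup>s - 1 = w\<^sup>s (1 - u\<^sup>s)\<close> of the strata of an essential face
  only depend on its type, and the powers of \<open>w\<close> add up to the mass.
\<close>

lemma prod_strata_eq_type:
  fixes u w :: "'a::comm_ring_1"
  assumes "finite \<tau>" and w: "w * u = 1"
  shows "(\<Prod>\<omega>\<in>\<tau>. w ^ card \<omega> - 1) =
         w ^ mass (face_type \<tau>) * (\<Prod>s\<in>supp (face_type \<tau>). (1 - u ^ s) ^ face_type \<tau> s)"
proof -
  have "(\<Prod>\<omega>\<in>\<tau>. w ^ card \<omega> - 1) =
      (\<Prod>s\<in>card ` \<tau>. \<Prod>\<omega>\<in>{\<omega> \<in> \<tau>. card \<omega> = s}. w ^ card \<omega> - 1)"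
    by (rule prod.image_gen[OF assms(1)])
  also have "\<dots> = (\<Prod>s\<in>card ` \<tau>. (w ^ s * (1 - u ^ s)) ^ face_type \<tau> s)"
    using w by (intro prod.cong) (simp_all add: face_type_def algebra_simps flip: power_mult_distrib)
  also have "\<dots> = (\<Prod>s\<in>card ` \<tau>. w ^ (s * face_type \<tau> s)) *
      (\<Prod>s\<in>card ` \<tau>. (1 - u ^ s) ^ face_type \<tau> s)"
    by (simp add: power_mult_distrib prod.distrib power_mult)
  also have "(\<Prod>s\<in>card ` \<tau>. w ^ (s * face_type \<tau> s)) = w ^ mass (face_type \<tau>)"
    by (simp add: mass_def supp_face_type[OF assms(1)] power_sum)
  finally show ?thesis by (simp add: supp_face_type[OF assms(1)])
qed

lemma sum_faces_by_type:
  fixes u w :: "'a::comm_ring_1"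
  assumes \<Delta>: "simplicial_complex V \<Delta>" and V: "finite V" and w: "w * u = 1"
  shows "(\<Sum>\<sigma>\<in>\<Delta>. (w - 1) ^ card \<sigma>) =
    (\<Sum>m\<in>{m \<in> multi_exponents (stratum_sizes V \<Delta>). face_multiplicity V \<Delta> m \<noteq> 0}.
       of_nat (face_multiplicity V \<Delta> m) * w ^ mass m * (\<Prod>s\<in>supp m. (1 - u ^ s) ^ m s))"
proof -
  let ?E = "essential_complex V \<Delta>"
  let ?h = "\<lambda>m. w ^ mass m * (\<Prod>s\<in>supp m. (1 - u ^ s) ^ m s)"
  have fin: "finite \<Delta>"
    using \<Delta> V finite_subset[of \<Delta> "Pow V"] by (simp add: simplicial_complex_def)
  then have finE: "finite ?E" by (simp add: essential_complex_def)
  have strata: "\<tau> \<subseteq> strata V \<Delta>" if "\<tau> \<in> ?E" for \<tau>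
    using that by (auto simp: essential_complex_def essential_face_def)
  have "strata V \<Delta> \<subseteq> Pow V" using strata_subset by blast
  then have fin_strata: "finite (strata V \<Delta>)" using V finite_subset by blast
  have fin\<tau>: "finite \<tau>" if "\<tau> \<in> ?E" for \<tau>
    using strata[OF that] fin_strata by (rule finite_subset)
  have fin\<omega>: "finite \<omega>" if "\<omega> \<in> strata V \<Delta>" for \<omega>
    using strata_subset[OF that] V by (rule finite_subset)
  have "(\<Sum>\<sigma>\<in>\<Delta>. (w - 1) ^ card \<sigma>) =
      (\<Sum>\<tau>\<in>?E. \<Sum>\<sigma>\<in>{\<sigma> \<in> \<Delta>. essential_face V \<Delta> \<sigma> = \<tau>}. (w - 1) ^ card \<sigma>)"
    unfolding essential_complex_def by (rule sum.image_gen[OF fin])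
  also have "\<dots> = (\<Sum>\<tau>\<in>?E. ?h (face_type \<tau>))"
  proof (rule sum.cong)
    fix \<tau> assume \<tau>: "\<tau> \<in> ?E"
    have "pairwise disjnt \<tau>"
      unfolding pairwise_def disjnt_def
    proof (intro ballI impI)
      fix \<omega> \<omega>' assume "\<omega> \<in> \<tau>" "\<omega>' \<in> \<tau>" "\<omega> \<noteq> \<omega>'"
      then show "\<omega> \<inter> \<omega>' = {}" using strata_disjoint[of \<omega> V \<Delta> \<omega>'] strata[OF \<tau>] by blast
    qed
    then have "(\<Sum>\<sigma>\<in>{\<sigma>. \<sigma> \<subseteq> \<Union>\<tau> \<and> (\<forall>\<omega>\<in>\<tau>. \<sigma> \<inter> \<omega> \<noteq> {})}. (w - 1) ^ card \<sigma>) =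
        (\<Prod>\<omega>\<in>\<tau>. w ^ card \<omega> - 1)"
      using sum_sets_meeting_all_blocks[of \<tau> "w - 1"] fin\<tau>[OF \<tau>] fin\<omega> strata[OF \<tau>]
      by (simp add: subset_iff)
    also have "\<dots> = ?h (face_type \<tau>)"
      by (rule prod_strata_eq_type[OF fin\<tau>[OF \<tau>] w])
    finally show "(\<Sum>\<sigma>\<in>{\<sigma> \<in> \<Delta>. essential_face V \<Delta> \<sigma> = \<tau>}. (w - 1) ^ card \<sigma>) = ?h (face_type \<tau>)"
      by (simp only: faces_over_essential_face[OF \<Delta> V \<tau>])
  qed simp
  also have "\<dots> = (\<Sum>m\<in>face_type ` ?E. \<Sum>\<tau>\<in>{\<tau> \<in> ?E. face_type \<tau> = m}. ?h (face_type \<tau>))"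
    by (rule sum.image_gen[OF finE])
  also have "\<dots> = (\<Sum>m\<in>face_type ` ?E. of_nat (face_multiplicity V \<Delta> m) * ?h m)"
    by (intro sum.cong) (simp_all add: face_multiplicity_def)
  also have "face_type ` ?E =
      {m \<in> multi_exponents (stratum_sizes V \<Delta>). face_multiplicity V \<Delta> m \<noteq> 0}"
  proof (rule subset_antisym; rule subsetI)
    fix m assume "m \<in> face_type ` ?E"
    then obtain \<tau> where \<tau>: "\<tau> \<in> ?E" "m = face_type \<tau>" by blast
    have "m s = 0" if "s \<notin> stratum_sizes V \<Delta>" for s
    proof -
      have "{\<omega> \<in> \<tau>. card \<omega> = s} = {}"
        using that strata[OF \<tau>(1)] by (auto simp: stratum_sizes_def)
      then show ?thesis by (simp only: \<tau> face_type_def card.empty)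
    qed
    moreover have "face_multiplicity V \<Delta> m \<noteq> 0"
      using \<tau> finE by (auto simp: face_multiplicity_def card_eq_0_iff)
    ultimately show "m \<in> {m \<in> multi_exponents (stratum_sizes V \<Delta>). face_multiplicity V \<Delta> m \<noteq> 0}"
      by (simp add: multi_exponents_def)
  next
    fix m assume "m \<in> {m \<in> multi_exponents (stratum_sizes V \<Delta>). face_multiplicity V \<Delta> m \<noteq> 0}"
    then have "{\<tau> \<in> ?E. face_type \<tau> = m} \<noteq> {}"
      by (auto simp: face_multiplicity_def simp del: Collect_empty_eq)
    then show "m \<in> face_type ` ?E" by blast
  qed
  finally show ?thesis by (simp add: mult.assoc)
qed

section \<open>The two formulas for the Hilbert series\<close>

text \<open>
  Power series do not form a field, so the rules for integer powers in division rings
  do not apply to a unit \<open>u\<close>.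
\<close>

lemma power_mult_powi_diff:
  fixes u :: "'a::field fps"
  assumes "fps_nth u 0 \<noteq> 0"
  shows "inverse u ^ N * u powi (int N - int k) = inverse u ^ k"
proof -
  have inv: "inverse u * u = 1" using assms by (rule inverse_mult_eq_1)
  show ?thesis
  proof (cases "k \<le> N")
    case True
    then have "inverse u ^ N = inverse u ^ k * inverse u ^ (N - k)" by (simp flip: power_add)
    moreover have "u powi (int N - int k) = u ^ (N - k)"
      using True by (simp flip: of_nat_diff)
    ultimately show ?thesis using inv by (simp add: mult.assoc flip: power_mult_distrib)
  next
    case False
    then have "u powi (int N - int k) = inverse u ^ (k - N)"
      by (simp add: power_int_def nat_diff_distrib)
    then show ?thesis using False by (simp flip: power_add)
  qed
qed

(* The sum over \<nat>\<^sup>B has finitely many nonzero terms and is taken over the m with g(m) \<noteq> 0.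
   S d is the sum with the exponents d - mu(m). For e > 0 the denominator (1 - t)^(d + e)
   requires the exponents d + e - mu(m), i.e. S (d + e): for V = {1} and \<Delta> = {{}} one has
   d = 0, e = 1 and Hilbert series 1, but S d / (1 - t)^(d + e) = 1 / (1 - t). *)
theorem theorem4p14:
  fixes n :: nat and \<Delta> :: "nat set set"
  assumes "simplicial_complex {1..n} \<Delta>"
  shows
    "let V = {1..n};
         H = hilbert_series TYPE('k::{alg_closed_field, field_char_0}) V \<Delta>;
         t = fps_X :: rat fps;
         f = face_number \<Delta>;
         d = nat (complex_dim \<Delta> + 1);
         e = card {i \<in> V. {i} \<notin> \<Delta>};
         B = stratum_sizes V \<Delta>;
         g = face_multiplicity V \<Delta>;
         S = (\<lambda>N::nat. \<Sum>m\<in>{m \<in> multi_exponents B. g m \<noteq> 0}.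
                of_nat (g m) * (1 - t) powi (int N - int (mass m)) *
                (\<Prod>s\<in>supp m. (1 - (1 - t) ^ s) ^ m s))
     in H = 1 / (1 - t) ^ d * (\<Sum>i=0..d. of_nat (f (int i - 1)) * (1 - t) ^ (d - i) * t ^ i) \<and>
        H = 1 / (1 - t) ^ (d + e) * S (d + e) \<and>
        (e = 0 \<longrightarrow> H = 1 / (1 - t) ^ (d + e) * S d)"
proof -
  let ?V = "{1..n}"
  let ?u = "1 - fps_X :: rat fps"
  let ?w = "inverse ?u"
  let ?d = "nat (complex_dim \<Delta> + 1)"
  let ?H = "hilbert_series TYPE('k) ?V \<Delta>"
  let ?M = "{m \<in> multi_exponents (stratum_sizes ?V \<Delta>). face_multiplicity ?V \<Delta> m \<noteq> 0}"
  let ?P = "\<lambda>m. \<Prod>s\<in>supp m. (1 - ?u ^ s) ^ m s"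
  have inv_pow: "1 / ?u ^ N = ?w ^ N" for N
    by (simp add: fps_divide_unit fps_inverse_power)
  have H: "?H = (\<Sum>\<sigma>\<in>\<Delta>. (fps_X * ?w) ^ card \<sigma>)"
    by (rule hilbert_series_eq_sum_faces[OF assms]) simp
  have 1: "?H = 1 / ?u ^ ?d *
      (\<Sum>i=0..?d. of_nat (face_number \<Delta> (int i - 1)) * ?u ^ (?d - i) * fps_X ^ i)"
    unfolding H inv_pow by (rule sum_faces_by_dimension[OF assms _ fps_geometric(1)]) simp
  have "fps_X * ?w = ?w - 1" by (subst (2) fps_geometric(3)) simp
  then have H': "?H = (\<Sum>m\<in>?M. of_nat (face_multiplicity ?V \<Delta> m) * ?w ^ mass m * ?P m)"
    unfolding H using sum_faces_by_type[OF assms _ fps_geometric(1)] by simp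
  have 2: "?H = 1 / ?u ^ N * (\<Sum>m\<in>?M. of_nat (face_multiplicity ?V \<Delta> m) *
      ?u powi (int N - int (mass m)) * ?P m)" for N
  proof -
    have "of_nat (face_multiplicity ?V \<Delta> m) * ?w ^ mass m * ?P m =
        ?w ^ N * (of_nat (face_multiplicity ?V \<Delta> m) * ?u powi (int N - int (mass m)) * ?P m)" for m
    proof -
      have "?w ^ mass m = ?w ^ N * ?u powi (int N - int (mass m))"
        by (rule power_mult_powi_diff[symmetric]) simp
      then show ?thesis by (simp only: mult_ac)
    qed
    then show ?thesis by (simp only: H' inv_pow sum_distrib_left)
  qed
  show ?thesis
    unfolding Let_def using 2[of ?d] by (intro conjI impI 1 2) (simp only: add_0_right)
qed

end
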